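(* Let $\Omega_{\alpha,\beta}$ be a well for $c$, with associated constant $c_1$, and let $\varepsilon>0$. Consider the eigenvalues $\lambda$ of $A_k$, $k\ge1$ (hence of $A$), such that $$c_m\,\mu_k^2\le\lambda\le(c_1-\varepsilon)\mu_k^2,$$ and let $v_\lambda(x',y)=\phi_k(x')u_{\lambda,k}(y)$ be the associated normalized eigenfunction. If $\overline{\Omega_{a,b}}\subseteq\overline{\Omega}\setminus\overline{\Omega_{\alpha,\beta}}$, then $$\lim_{\lambda\to\infty}\int_{\Omega_{a,b}}|v_\lambda(x)|^2\,dx=0,$$ the limit being taken over all such $k$ and $\lambda$ with $\lambda\to\infty$.
   Context: $\Omega'\subset\mathbb{R}^d$ ($d\ge1$) is a fixed bounded smooth open domain, $H>0$ is fixed, $\Omega=\Omega'\times(0,H)$ with coordinates $x=(x',y)$. $\{(\mu_k^2,\phi_k)\}_{k\ge1}$ is the sequence of eigenvalues (nondecreasing, with multiplicity, $\mu_k>0$) and $L^2$-normalized eigenfunctions (forming an orthonormal basis of $L^2(\Omega')$) of the Dirichlet Laplacian $-\Delta_{x'}$ in $L^2(\Omega')$. The coefficient $c\in L^\infty([0,H])$ satisfies $0<c_m:=\operatorname{ess\,inf}c<c_M:=\operatorname{ess\,sup}c$; no continuity is assumed. Set $\tilde c(x',y)=c(y)$; $A=-\nabla\cdot\tilde c\,\nabla$ is the self-adjoint operator in $L^2(\Omega)$ with homogeneous Dirichlet boundary conditions. By separation of variables $A$ is unitarily equivalent to $\bigoplus_{k\ge1}A_k$ on $\bigoplus_k L^2(0,H)$,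 where $$A_k=c(y)\mu_k^2-\frac{d}{dy}c(y)\frac{d}{dy},\qquad D(A_k)=\{u\in H^1_0(0,H):\ cu'\in H^1(0,H)\}.$$ All eigenvalues of $A_k$ are simple; if $\lambda$ is an eigenvalue of $A_k$, $u_{\lambda,k}$ denotes the (real) eigenfunction of $A_k$ for $\lambda$, normalized in $L^2(0,H)$. For $a<b$ with $(a,b)\subseteq(0,H)$, the layer $\Omega_{a,b}$ is $\Omega'\times(a,b)\subseteq\Omega$. A layer $\Omega_{\alpha,\beta}$ is a well for the profile $c$ if there exists $c_1>0$ such that $0<c_m<c_1$ and $c(y)\ge c_1$ for a.e. $y\in(0,H)\setminus(\alpha,\beta)$. *)

theory Defs
  imports "HOL-Probability.Essential_Supremum"
begin

section \<open>Smooth functions and smooth domains\<close>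

definition partial :: "'a::euclidean_space \<Rightarrow> ('a \<Rightarrow> 'b::real_normed_vector) \<Rightarrow> 'a \<Rightarrow> 'b" where
  "partial b f x = frechet_derivative f (at x) b"

text \<open>Intended for open \<open>S\<close>; the derivative is the one at \<open>x\<close> in the whole space.\<close>

primrec Ck_on :: "nat \<Rightarrow> 'a::euclidean_space set \<Rightarrow> ('a \<Rightarrow> 'b::real_normed_vector) \<Rightarrow> bool" where
  "Ck_on 0 S f \<longleftrightarrow> continuous_on S f"
| "Ck_on (Suc n) S f \<longleftrightarrow>
     (\<forall>x\<in>S. f differentiable (at x)) \<and> (\<forall>b\<in>Basis. Ck_on n S (partial b f))"

definition smooth_on :: "'a::euclidean_space set \<Rightarrow> ('a \<Rightarrow> 'b::real_normed_vector) \<Rightarrow> bool" where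
  "smooth_on S f \<longleftrightarrow> (\<forall>n. Ck_on n S f)"

text \<open>The boundary is smooth: near each boundary point the domain is a sublevel set of a smooth
  function without critical points.  Such a domain lies locally on one side of its boundary.\<close>

definition bounded_smooth_domain :: "'a::euclidean_space set \<Rightarrow> bool" where
  "bounded_smooth_domain U \<longleftrightarrow>
     open U \<and> connected U \<and> bounded U \<and> U \<noteq> {} \<and>
     (\<forall>p\<in>frontier U. \<exists>V (\<rho> :: 'a \<Rightarrow> real). open V \<and> p \<in> V \<and> smooth_on V \<rho> \<and>
        (\<forall>x\<in>V. \<exists>b\<in>Basis. partial b \<rho> x \<noteq> 0) \<and>
        U \<inter> V = {x \<in> V. \<rho> x < 0})"


section \<open>Lebesgue and Sobolev spaces\<close>

text \<open>The spaces consist of functions rather than of classes of functions; all notions below are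
  invariant under changes on null sets.  Scalars are complex.\<close>

definition L2 :: "'a::euclidean_space set \<Rightarrow> ('a \<Rightarrow> complex) set" where
  "L2 U = {f. f \<in> borel_measurable (lebesgue_on U) \<and>
              integrable (lebesgue_on U) (\<lambda>x. (cmod (f x))\<^sup>2)}"

definition l2_inner :: "'a::euclidean_space set \<Rightarrow> ('a \<Rightarrow> complex) \<Rightarrow> ('a \<Rightarrow> complex) \<Rightarrow> complex" where
  "l2_inner U f g = (LINT x|lebesgue_on U. f x * cnj (g x))"

definition l2_norm :: "'a::euclidean_space set \<Rightarrow> ('a \<Rightarrow> complex) \<Rightarrow> real" where
  "l2_norm U f = sqrt (LINT x|lebesgue_on U. (cmod (f x))\<^sup>2)"

definition Linf :: "'a::euclidean_space set \<Rightarrow> ('a \<Rightarrow> real) set" where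
  "Linf S = {f. f \<in> borel_measurable (lebesgue_on S) \<and>
                (\<exists>B. AE x in lebesgue_on S. \<bar>f x\<bar> \<le> B)}"

definition ess_sup_on :: "'a::euclidean_space set \<Rightarrow> ('a \<Rightarrow> real) \<Rightarrow> real" where
  "ess_sup_on S f = real_of_ereal (esssup (lebesgue_on S) (\<lambda>x. ereal (f x)))"

definition ess_inf_on :: "'a::euclidean_space set \<Rightarrow> ('a \<Rightarrow> real) \<Rightarrow> real" where
  "ess_inf_on S f = - ess_sup_on S (\<lambda>x. - f x)"

definition test_fun :: "'a::euclidean_space set \<Rightarrow> ('a \<Rightarrow> complex) \<Rightarrow> bool" where
  "test_fun U \<psi> \<longleftrightarrow> smooth_on UNIV \<psi> \<and> compact (closure {x. \<psi> x \<noteq> 0}) \<and>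
                   closure {x. \<psi> x \<noteq> 0} \<subseteq> U"

definition weak_deriv ::
    "'a::euclidean_space set \<Rightarrow> 'a \<Rightarrow> ('a \<Rightarrow> complex) \<Rightarrow> ('a \<Rightarrow> complex) \<Rightarrow> bool" where
  "weak_deriv U b u g \<longleftrightarrow> u \<in> L2 U \<and> g \<in> L2 U \<and>
     (\<forall>\<psi>. test_fun U \<psi> \<longrightarrow>
        (LINT x|lebesgue_on U. u x * partial b \<psi> x) = - (LINT x|lebesgue_on U. g x * \<psi> x))"

definition H1 :: "'a::euclidean_space set \<Rightarrow> ('a \<Rightarrow> complex) set" where
  "H1 U = {u \<in> L2 U. \<forall>b\<in>Basis. \<exists>g. weak_deriv U b u g}"

text \<open>The closure of the test functions in \<open>H1\<close>.  The quantifier over \<open>g\<close> is harmless: weak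
  derivatives are unique up to null sets.\<close>

definition H10 :: "'a::euclidean_space set \<Rightarrow> ('a \<Rightarrow> complex) set" where
  "H10 U = {u \<in> H1 U. \<exists>\<psi>. (\<forall>n. test_fun U (\<psi> n)) \<and>
     (\<lambda>n. l2_norm U (\<lambda>x. u x - \<psi> n x)) \<longlonglongrightarrow> 0 \<and>
     (\<forall>b\<in>Basis. \<forall>g. weak_deriv U b u g \<longrightarrow>
        (\<lambda>n. l2_norm U (\<lambda>x. g x - partial b (\<psi> n) x)) \<longlonglongrightarrow> 0)}"

definition orthonormal_basis ::
    "'a::euclidean_space set \<Rightarrow> nat set \<Rightarrow> (nat \<Rightarrow> 'a \<Rightarrow> complex) \<Rightarrow> bool" where
  "orthonormal_basis U K \<phi> \<longleftrightarrow>
     (\<forall>k\<in>K. \<phi> k \<in> L2 U) \<and>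
     (\<forall>j\<in>K. \<forall>k\<in>K. l2_inner U (\<phi> j) (\<phi> k) = (if j = k then 1 else 0)) \<and>
     (\<forall>f\<in>L2 U. (\<lambda>n. l2_norm U (\<lambda>x. f x - (\<Sum>k\<in>K \<inter> {..n}. l2_inner U f (\<phi> k) * \<phi> k x)))
        \<longlonglongrightarrow> 0)"


section \<open>The operators\<close>

text \<open>An unbounded operator in \<open>L2\<close> is given by its graph.\<close>

definition eigenfunction ::
    "'a::euclidean_space set \<Rightarrow> (('a \<Rightarrow> complex) \<times> ('a \<Rightarrow> complex)) set \<Rightarrow> real \<Rightarrow>
     ('a \<Rightarrow> complex) \<Rightarrow> bool" where
  "eigenfunction U T l u \<longleftrightarrow>
     (u, \<lambda>x. of_real l * u x) \<in> T \<and> \<not> (AE x in lebesgue_on U. u x = 0)"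

definition eigenvalue ::
    "'a::euclidean_space set \<Rightarrow> (('a \<Rightarrow> complex) \<times> ('a \<Rightarrow> complex)) set \<Rightarrow> real \<Rightarrow> bool" where
  "eigenvalue U T l \<longleftrightarrow> (\<exists>u. eigenfunction U T l u)"

text \<open>The operator \<open>-\<Delta>\<close> with domain consisting of the \<open>u \<in> H10 U\<close> with distributional
  Laplacian in \<open>L2 U\<close>; here \<open>g\<close> is the weak gradient of \<open>u\<close>.\<close>

definition dirichlet_laplacian ::
    "'a::euclidean_space set \<Rightarrow> (('a \<Rightarrow> complex) \<times> ('a \<Rightarrow> complex)) set" where
  "dirichlet_laplacian U = {(u, f). u \<in> H10 U \<and> f \<in> L2 U \<and>
     (\<exists>g. (\<forall>b\<in>Basis. weak_deriv U b u (g b)) \<and>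
       (\<forall>\<psi>. test_fun U \<psi> \<longrightarrow>
          (LINT x|lebesgue_on U. (\<Sum>b\<in>Basis. g b x * partial b \<psi> x)) =
          (LINT x|lebesgue_on U. f x * \<psi> x)))}"

text \<open>The operator \<open>u \<mapsto> c \<mu>\<^sup>2 u - (c u')'\<close> in \<open>L2 {0<..<H}\<close> with domain
  \<open>{u \<in> H10 {0<..<H}. c u' \<in> H1 {0<..<H}}\<close>; here \<open>w\<close> is \<open>u'\<close> and \<open>z\<close> is \<open>(c u')'\<close>.\<close>

definition reduced_operator ::
    "real \<Rightarrow> (real \<Rightarrow> real) \<Rightarrow> real \<Rightarrow> ((real \<Rightarrow> complex) \<times> (real \<Rightarrow> complex)) set" where
  "reduced_operator H c \<mu> = {(u, f). u \<in> H10 {0<..<H} \<and> f \<in> L2 {0<..<H} \<and>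
     (\<exists>w z. weak_deriv {0<..<H} 1 u w \<and> weak_deriv {0<..<H} 1 (\<lambda>y. of_real (c y) * w y) z \<and>
       (AE y in lebesgue_on {0<..<H}. f y = of_real (c y * \<mu>\<^sup>2) * u y - z y))}"


section \<open>Layers and wells\<close>

definition layer :: "'a::euclidean_space set \<Rightarrow> real \<Rightarrow> real \<Rightarrow> ('a \<times> real) set" where
  "layer U a b = U \<times> {a<..<b}"

definition well :: "real \<Rightarrow> (real \<Rightarrow> real) \<Rightarrow> real \<Rightarrow> real \<Rightarrow> real \<Rightarrow> bool" where
  "well H c \<alpha> \<beta> c1 \<longleftrightarrow> \<alpha> < \<beta> \<and> {\<alpha><..<\<beta>} \<subseteq> {0<..<H} \<and>
     0 < ess_inf_on {0..H} c \<and> ess_inf_on {0..H} c < c1 \<and>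
     (AE y in lebesgue_on ({0<..<H} - {\<alpha><..<\<beta>}). c1 \<le> c y)"

end

theory Submission
  imports Defs
begin

text \<open>
  Only the regime \<open>\<mu> \<rightarrow> \<infinity>\<close> matters, because \<open>\<lambda> \<le> (c\<^sub>1 - \<epsilon>) \<mu>\<^sup>2\<close> makes \<open>\<mu>\<^sup>2\<close> grow at least
  linearly with \<open>\<lambda>\<close>.  Outside the well the reduced equation \<open>(c u')' = (c \<mu>\<^sup>2 - \<lambda>) u\<close> is classically
  forbidden: there \<open>c \<mu>\<^sup>2 - \<lambda> \<ge> \<epsilon> \<mu>\<^sup>2\<close>.  Multiplying the equation by \<open>\<eta>\<^sup>2\<close> times the conjugate of
  \<open>u\<close>, where \<open>\<eta>\<close> is a cutoff that vanishes on the well, and integrating by parts gives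
  \[
    \int c \eta^2 |u'|^2 + \int (c \mu^2 - \lambda) \eta^2 |u|^2
      = - 2\, \mathrm{Re} \int c \eta \eta' u' \overline{u}
      \le \int c \eta^2 |u'|^2 + \int c \eta'^2 |u|^2 .
  \]
  The gradient terms cancel (\<open>Caccioppoli_inequality\<close>), and what is left bounds \<open>\<epsilon> \<mu>\<^sup>2 \<integral> \<eta>\<^sup>2 |u|\<^sup>2\<close>
  by a constant that does not depend on \<open>\<mu>\<close> or \<open>\<lambda>\<close>.  As \<open>(a, b)\<close> has positive distance from the
  well, \<open>\<eta>\<close> can be kept away from zero on \<open>(a, b)\<close>, so the mass of \<open>u\<close> on \<open>(a, b)\<close> is
  \<open>O(1 / \<mu>\<^sup>2) = O(1 / \<lambda>)\<close> (\<open>eigenfunction_mass_outside_well\<close>).  By Tonelli's theorem the mass of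
  \<open>v\<^sub>\<lambda>\<close> in the layer is the same number, because \<open>\<phi>\<^sub>k\<close> is normalized (\<open>LINT_cmod_power2_layer\<close>).

  The coefficient is only bounded and measurable, so \<open>u\<close> is a weak solution.  The equation is first
  tested with \<open>\<eta>\<^sup>2\<close> times the conjugate of a test function, and density of the test functions in
  \<open>H10\<close> then allows \<open>u\<close> itself (\<open>weak_equation_extends_to_H10\<close>).  For the product to be a test
  function again, \<open>\<eta>\<close> has to be smooth; it is built from \<open>exp (- 1 / x)\<close>.
\<close>


section \<open>Square-integrable functions\<close>

lemma L2_mult_bounded:
  fixes f :: "'a::euclidean_space \<Rightarrow> complex" and m :: "'a \<Rightarrow> real"
  assumes "f \<in> L2 U" and m: "m \<in> borel_measurable (lebesgue_on U)"
    and bd: "AE x in lebesgue_on U. \<bar>m x\<bar> \<le> B"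
  shows "(\<lambda>x. m x *\<^sub>R f x) \<in> L2 U"
proof -
  have f: "f \<in> borel_measurable (lebesgue_on U)"
    and i: "integrable (lebesgue_on U) (\<lambda>x. (cmod (f x))\<^sup>2)"
    using assms(1) by (auto simp: L2_def)
  have "integrable (lebesgue_on U) (\<lambda>x. (cmod (m x *\<^sub>R f x))\<^sup>2)"
  proof (rule Bochner_Integration.integrable_bound)
    show "integrable (lebesgue_on U) (\<lambda>x. B\<^sup>2 * (cmod (f x))\<^sup>2)"
      using i by simp
    show "(\<lambda>x. (cmod (m x *\<^sub>R f x))\<^sup>2) \<in> borel_measurable (lebesgue_on U)"
      using f m by measurable
    show "AE x in lebesgue_on U. norm ((cmod (m x *\<^sub>R f x))\<^sup>2) \<le> norm (B\<^sup>2 * (cmod (f x))\<^sup>2)"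
      using bd
    proof eventually_elim
      case (elim x)
      then have "(m x)\<^sup>2 \<le> B\<^sup>2"
        using abs_le_square_iff by fastforce
      then show ?case
        by (simp add: power_mult_distrib mult_right_mono)
    qed
  qed
  then show ?thesis
    using f m unfolding L2_def by simp
qed

lemma L2_add:
  assumes "f \<in> L2 U" "g \<in> L2 U"
  shows "(\<lambda>x. f x + g x) \<in> L2 U"
proof -
  have f: "f \<in> borel_measurable (lebesgue_on U)" "g \<in> borel_measurable (lebesgue_on U)"
    and i: "integrable (lebesgue_on U) (\<lambda>x. (cmod (f x))\<^sup>2)"
     "integrable (lebesgue_on U) (\<lambda>x. (cmod (g x))\<^sup>2)"
    using assms by (auto simp: L2_def)
  have "integrable (lebesgue_on U) (\<lambda>x. (cmod (f x + g x))\<^sup>2)"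
  proof (rule Bochner_Integration.integrable_bound)
    show "integrable (lebesgue_on U) (\<lambda>x. 2 * (cmod (f x))\<^sup>2 + 2 * (cmod (g x))\<^sup>2)"
      using i by simp
    show "(\<lambda>x. (cmod (f x + g x))\<^sup>2) \<in> borel_measurable (lebesgue_on U)"
      using f by measurable
    have "(cmod (f x + g x))\<^sup>2 \<le> 2 * (cmod (f x))\<^sup>2 + 2 * (cmod (g x))\<^sup>2" for x
    proof -
      have "(cmod (f x + g x))\<^sup>2 \<le> (cmod (f x) + cmod (g x))\<^sup>2"
        by (intro power_mono norm_triangle_ineq) auto
      also have "\<dots> \<le> 2 * (cmod (f x))\<^sup>2 + 2 * (cmod (g x))\<^sup>2"
        using sum_squares_bound[of "cmod (f x)" "cmod (g x)"] by (simp add: power2_sum)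
      finally show ?thesis .
    qed
    then show "AE x in lebesgue_on U. norm ((cmod (f x + g x))\<^sup>2) \<le>
        norm (2 * (cmod (f x))\<^sup>2 + 2 * (cmod (g x))\<^sup>2)"
      by simp
  qed
  then show ?thesis
    using f unfolding L2_def by simp
qed

lemma L2_diff:
  assumes "f \<in> L2 U" "g \<in> L2 U"
  shows "(\<lambda>x. f x - g x) \<in> L2 U"
  using L2_add[OF assms(1) L2_mult_bounded[OF assms(2), of "\<lambda>_. - 1" 1]] by simp

lemma L2_continuous:
  fixes f :: "'a::euclidean_space \<Rightarrow> complex"
  assumes U: "U \<in> lmeasurable" "bounded U" and f: "continuous_on UNIV f"
  shows "f \<in> L2 U"
proof -
  have "compact (f ` closure U)"
    using U(2) f by (meson compact_closure compact_continuous_image continuous_on_subset subset_UNIV)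
  then obtain B where B: "\<And>x. x \<in> U \<Longrightarrow> cmod (f x) \<le> B"
    by (metis bounded_iff closure_subset compact_imp_bounded image_eqI subset_iff)
  have m: "f \<in> borel_measurable (lebesgue_on U)"
    using f U(1) continuous_imp_measurable_on_sets_lebesgue continuous_on_subset
    by (metis fmeasurableD subset_UNIV)
  interpret finite_measure "lebesgue_on U"
    using U(1) by (rule finite_measure_lebesgue_on)
  have "integrable (lebesgue_on U) (\<lambda>x. (cmod (f x))\<^sup>2)"
  proof (rule integrable_const_bound[of _ "B\<^sup>2"])
    show "AE x in lebesgue_on U. norm ((cmod (f x))\<^sup>2) \<le> B\<^sup>2"
      using U(1) B by (auto intro!: AE_I2 power_mono)
  qed (use m in measurable)
  then show ?thesis
    using m by (simp add: L2_def)
qed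

lemma integrable_L2_inner:
  assumes "f \<in> L2 U" "g \<in> L2 U"
  shows "integrable (lebesgue_on U) (\<lambda>x. f x * cnj (g x))"
proof -
  have f: "f \<in> borel_measurable (lebesgue_on U)" "g \<in> borel_measurable (lebesgue_on U)"
    and i: "integrable (lebesgue_on U) (\<lambda>x. (cmod (f x))\<^sup>2)"
     "integrable (lebesgue_on U) (\<lambda>x. (cmod (g x))\<^sup>2)"
    using assms by (auto simp: L2_def)
  show ?thesis
  proof (rule Bochner_Integration.integrable_bound)
    show "integrable (lebesgue_on U) (\<lambda>x. (cmod (f x))\<^sup>2 + (cmod (g x))\<^sup>2)"
      using i by simp
    show "(\<lambda>x. f x * cnj (g x)) \<in> borel_measurable (lebesgue_on U)"
      using f borel_measurable_continuous_onI[OF continuous_on_cnj[OF continuous_on_id]]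
      by (auto intro!: borel_measurable_times measurable_compose[of g])
    have "cmod (f x) * cmod (g x) \<le> (cmod (f x))\<^sup>2 + (cmod (g x))\<^sup>2" for x
      using sum_squares_bound[of "cmod (f x)" "cmod (g x)"]
        mult_nonneg_nonneg[OF norm_ge_zero norm_ge_zero, of "f x" "g x"] by linarith
    then show "AE x in lebesgue_on U. norm (f x * cnj (g x)) \<le>
        norm ((cmod (f x))\<^sup>2 + (cmod (g x))\<^sup>2)"
      by (simp add: norm_mult)
  qed
qed

text \<open>Integrating \<open>2 s |f| |g| \<le> s\<^sup>2 |f|\<^sup>2 + |g|\<^sup>2\<close> gives a quadratic in \<open>s\<close> that is nonnegative for
  every \<open>s\<close>; the inequality is its discriminant condition, read off at the minimizing \<open>s\<close>.\<close>

lemma l2_inner_Cauchy_Schwarz: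
  assumes "f \<in> L2 U" "g \<in> L2 U"
  shows "cmod (l2_inner U f g) \<le> l2_norm U f * l2_norm U g"
proof -
  define A where "A = (LINT x|lebesgue_on U. (cmod (f x))\<^sup>2)"
  define B where "B = (LINT x|lebesgue_on U. (cmod (g x))\<^sup>2)"
  define I where "I = (LINT x|lebesgue_on U. cmod (f x) * cmod (g x))"
  have i: "integrable (lebesgue_on U) (\<lambda>x. (cmod (f x))\<^sup>2)"
     "integrable (lebesgue_on U) (\<lambda>x. (cmod (g x))\<^sup>2)"
    using assms by (auto simp: L2_def)
  have j: "integrable (lebesgue_on U) (\<lambda>x. cmod (f x) * cmod (g x))"
    using integrable_norm[OF integrable_L2_inner[OF assms]] by (simp add: norm_mult)
  have nn: "0 \<le> A" "0 \<le> B"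
    unfolding A_def B_def by simp_all
  have le: "cmod (l2_inner U f g) \<le> I"
    unfolding l2_inner_def I_def
    using integral_norm_bound[of "lebesgue_on U" "\<lambda>x. f x * cnj (g x)"] by (simp add: norm_mult)
  have key: "s * 2 * I \<le> s\<^sup>2 * A + B" for s
  proof -
    have "(LINT x|lebesgue_on U. s * 2 * (cmod (f x) * cmod (g x))) \<le>
          (LINT x|lebesgue_on U. s\<^sup>2 * (cmod (f x))\<^sup>2 + (cmod (g x))\<^sup>2)"
    proof (rule integral_mono)
      show "s * 2 * (cmod (f x) * cmod (g x)) \<le> s\<^sup>2 * (cmod (f x))\<^sup>2 + (cmod (g x))\<^sup>2" for x
        using sum_squares_bound[of "s * cmod (f x)" "cmod (g x)"]
        by (simp add: power_mult_distrib mult_ac)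
    qed (use i j in simp_all)
    then show ?thesis
      using i j by (simp add: A_def B_def I_def)
  qed
  have "I\<^sup>2 \<le> A * B"
  proof (cases "A = 0")
    case True
    \<comment> \<open>Here the bound on \<open>I\<close> is linear in the free parameter, which forces \<open>I \<le> 0\<close>.\<close>
    have "0 \<le> I"
      unfolding I_def by simp
    moreover have "I \<le> 0"
    proof (rule ccontr)
      assume "\<not> I \<le> 0"
      then show False
        using key[of "(B + 1) / (2 * I)"] True by simp
    qed
    ultimately show ?thesis
      using nn by simp
  next
    case False
    then have "(I / A)\<^sup>2 * A = I\<^sup>2 / A" "I / A * 2 * I = 2 * (I\<^sup>2 / A)"
      by (simp_all add: power2_eq_square)
    then have "I\<^sup>2 / A \<le> B"
      using key[of "I / A"] by linarith
    then show ?thesis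
      using False nn by (simp add: divide_le_eq mult.commute)
  qed
  then have "I \<le> sqrt (A * B)"
    by (rule real_le_rsqrt)
  then show ?thesis
    using le by (simp add: l2_norm_def A_def B_def real_sqrt_mult)
qed

lemma tendsto_l2_inner:
  assumes F: "F \<in> L2 U" and h: "\<And>n. h n \<in> L2 U" and g: "g \<in> L2 U"
    and lim: "(\<lambda>n. l2_norm U (\<lambda>x. g x - h n x)) \<longlonglongrightarrow> 0"
  shows "(\<lambda>n. l2_inner U F (h n)) \<longlonglongrightarrow> l2_inner U F g"
proof (rule Lim_transform2[OF tendsto_const])
  have eq: "l2_inner U F g - l2_inner U F (h n) = l2_inner U F (\<lambda>x. g x - h n x)" for n
    using Bochner_Integration.integral_diff[OF integrable_L2_inner[OF F g] integrable_L2_inner[OF F h[of n]]]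
    by (simp add: l2_inner_def algebra_simps)
  have "(\<lambda>n. l2_norm U F * l2_norm U (\<lambda>x. g x - h n x)) \<longlonglongrightarrow> l2_norm U F * 0"
    by (intro tendsto_intros lim)
  then have lim': "(\<lambda>n. l2_norm U F * l2_norm U (\<lambda>x. g x - h n x)) \<longlonglongrightarrow> 0"
    by simp
  show "(\<lambda>n. l2_inner U F g - l2_inner U F (h n)) \<longlonglongrightarrow> 0"
    unfolding eq
  proof (rule Lim_null_comparison[OF _ lim'], rule always_eventually, rule allI)
    show "cmod (l2_inner U F (\<lambda>x. g x - h n x)) \<le> l2_norm U F * l2_norm U (\<lambda>x. g x - h n x)" for n
      by (rule l2_inner_Cauchy_Schwarz[OF F L2_diff[OF g h]])
  qed
qed


section \<open>Smooth functions and weak equations\<close>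

lemma partial_has_derivative:
  "(f has_derivative f') (at x) \<Longrightarrow> partial b f x = f' b"
  unfolding partial_def using frechet_derivative_at by metis

lemma Ck_on_imp_continuous_on: "Ck_on n S f \<Longrightarrow> continuous_on S f"
  by (cases n) (auto intro!: continuous_at_imp_continuous_on differentiable_imp_continuous_within)

lemma Ck_on_Suc_imp: "Ck_on (Suc n) S f \<Longrightarrow> Ck_on n S f"
proof (induction n arbitrary: f)
  case 0
  then show ?case
    using Ck_on_imp_continuous_on by (simp only: Ck_on.simps(1))
next
  case (Suc n)
  then show ?case
    by (metis Ck_on.simps(2))
qed

lemma Ck_on_add:
  assumes "Ck_on n UNIV f" "Ck_on n UNIV g"
  shows "Ck_on n UNIV (\<lambda>x. f x + g x)"
  using assms
proof (induction n arbitrary: f g)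
  case (Suc n)
  have "partial b (\<lambda>x. f x + g x) = (\<lambda>x. partial b f x + partial b g x)" for b
  proof
    fix x
    have "(f has_derivative frechet_derivative f (at x)) (at x)"
      "(g has_derivative frechet_derivative g (at x)) (at x)"
      using Suc.prems by (auto simp: frechet_derivative_works)
    from has_derivative_add[OF this] show "partial b (\<lambda>x. f x + g x) x = partial b f x + partial b g x"
      by (simp add: partial_has_derivative) (simp add: partial_def)
  qed
  then show ?case
    using Suc by auto
qed (auto intro: continuous_intros)

lemma partial_bounded_linear:
  assumes "bounded_linear L" "f differentiable (at x)"
  shows "partial b (\<lambda>x. L (f x)) x = L (partial b f x)"
proof -
  have "(f has_derivative frechet_derivative f (at x)) (at x)"
    using assms by (auto simp: frechet_derivative_works)
  from bounded_linear.has_derivative[OF assms(1) this] show ?thesis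
    by (simp add: partial_has_derivative) (simp add: partial_def)
qed

lemma Ck_on_bounded_linear:
  assumes L: "bounded_linear L" and "Ck_on n UNIV f"
  shows "Ck_on n UNIV (\<lambda>x. L (f x))"
  using assms(2)
proof (induction n arbitrary: f)
  case 0
  then show ?case
    using L by (auto intro: bounded_linear.continuous_on)
next
  case (Suc n)
  then have "partial b (\<lambda>x. L (f x)) = (\<lambda>x. L (partial b f x))" for b
    using partial_bounded_linear[OF L] by fastforce
  moreover have "(\<lambda>x. L (f x)) differentiable (at x)" for x
    using Suc.prems unfolding differentiable_def Ck_on.simps
    by (blast intro: bounded_linear.has_derivative[OF L])
  ultimately show ?case
    using Suc by simp
qed

lemma partial_scaleR:
  assumes "f differentiable (at x)" "g differentiable (at x)"
  shows "partial b (\<lambda>x. f x *\<^sub>R g x) x = f x *\<^sub>R partial b g x + partial b f x *\<^sub>R g x"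
proof -
  have "(f has_derivative frechet_derivative f (at x)) (at x)"
    "(g has_derivative frechet_derivative g (at x)) (at x)"
    using assms by (auto simp: frechet_derivative_works)
  from has_derivative_scaleR[OF this] show ?thesis
    by (simp add: partial_has_derivative) (simp add: partial_def)
qed

text \<open>The induction needs both the factors and their derivatives at the lower order, since the Leibniz
  rule produces each factor undifferentiated in one of the two terms.\<close>

lemma Ck_on_scaleR:
  assumes "Ck_on n UNIV f" "Ck_on n UNIV g"
  shows "Ck_on n UNIV (\<lambda>x. f x *\<^sub>R g x)"
  using assms
proof (induction n arbitrary: f g)
  case (Suc n)
  have d: "\<forall>x. f differentiable (at x)" "\<forall>x. g differentiable (at x)"
    using Suc.prems by auto
  then have *: "partial b (\<lambda>x. f x *\<^sub>R g x) = (\<lambda>x. f x *\<^sub>R partial b g x + partial b f x *\<^sub>R g x)" for b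
    using partial_scaleR by blast
  have "Ck_on n UNIV (\<lambda>x. f x *\<^sub>R partial b g x + partial b f x *\<^sub>R g x)" if "b \<in> Basis" for b
    using Suc.prems that by (intro Ck_on_add Suc.IH) (auto intro: Ck_on_Suc_imp simp del: Ck_on.simps, auto)
  then show ?case
    using d by (simp add: * )
qed (auto intro: continuous_intros)

lemma smooth_on_differentiable: "smooth_on UNIV f \<Longrightarrow> f differentiable (at x)"
  unfolding smooth_on_def by (metis Ck_on.simps(2) UNIV_I)

lemma smooth_on_continuous: "smooth_on S f \<Longrightarrow> continuous_on S f"
  unfolding smooth_on_def using Ck_on_imp_continuous_on by blast

lemma smooth_on_partial: "smooth_on S f \<Longrightarrow> b \<in> Basis \<Longrightarrow> smooth_on S (partial b f)"
  unfolding smooth_on_def by (metis Ck_on.simps(2))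

lemma smooth_on_scaleR:
  "smooth_on UNIV f \<Longrightarrow> smooth_on UNIV g \<Longrightarrow> smooth_on UNIV (\<lambda>x. f x *\<^sub>R g x)"
  by (simp add: smooth_on_def Ck_on_scaleR)

lemma smooth_on_cnj: "smooth_on UNIV f \<Longrightarrow> smooth_on UNIV (\<lambda>x. cnj (f x))"
  by (simp add: smooth_on_def Ck_on_bounded_linear[OF bounded_linear_cnj])

text \<open>The weak formulation pairs functions without a conjugate, so energies \<open>|u|\<^sup>2\<close> of complex functions
  arise from conjugated test functions.\<close>

lemma test_fun_scaleR_cnj:
  assumes "smooth_on UNIV f" "test_fun U \<psi>"
  shows "test_fun U (\<lambda>x. f x *\<^sub>R cnj (\<psi> x))"
proof -
  have sub: "closure {x. f x *\<^sub>R cnj (\<psi> x) \<noteq> 0} \<subseteq> closure {x. \<psi> x \<noteq> 0}"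
    by (intro closure_mono) auto
  then have "compact (closure {x. f x *\<^sub>R cnj (\<psi> x) \<noteq> 0})"
    using assms(2) compact_Int_closed[of "closure {x. \<psi> x \<noteq> 0}" "closure {x. f x *\<^sub>R cnj (\<psi> x) \<noteq> 0}"]
    by (simp add: test_fun_def inf.absorb2)
  moreover have "smooth_on UNIV (\<lambda>x. f x *\<^sub>R cnj (\<psi> x))"
    using assms by (intro smooth_on_scaleR smooth_on_cnj) (auto simp: test_fun_def)
  ultimately show ?thesis
    using assms(2) sub unfolding test_fun_def by blast
qed

text \<open>Both pairings are continuous in \<open>L2\<close>, so an equation in weak form that holds for test functions
  passes to the limit along a sequence of test functions that approximates \<open>u\<close> in the \<open>H1\<close> norm.\<close>

lemma weak_equation_extends_to_H10:
  assumes U: "U \<in> lmeasurable" "bounded U" and b: "b \<in> Basis"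
    and u: "u \<in> H10 U" "weak_deriv U b u w"
    and F: "F \<in> L2 U" and G: "G \<in> L2 U"
    and eq: "\<And>\<psi>. test_fun U \<psi> \<Longrightarrow> l2_inner U F (partial b \<psi>) + l2_inner U G \<psi> = 0"
  shows "l2_inner U F w + l2_inner U G u = 0"
proof -
  obtain \<psi> where \<psi>: "\<And>n. test_fun U (\<psi> n)" "(\<lambda>n. l2_norm U (\<lambda>x. u x - \<psi> n x)) \<longlonglongrightarrow> 0"
    "(\<lambda>n. l2_norm U (\<lambda>x. w x - partial b (\<psi> n) x)) \<longlonglongrightarrow> 0"
    using u b unfolding H10_def by blast
  have uw: "u \<in> L2 U" "w \<in> L2 U"
    using u by (auto simp: weak_deriv_def)
  have s: "smooth_on UNIV (\<psi> n)" for n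
    using \<psi>(1) by (simp add: test_fun_def)
  have "\<psi> n \<in> L2 U" "partial b (\<psi> n) \<in> L2 U" for n
    using U s b by (blast intro: L2_continuous smooth_on_continuous smooth_on_partial)+
  then have "(\<lambda>n. l2_inner U F (partial b (\<psi> n)) + l2_inner U G (\<psi> n)) \<longlonglongrightarrow> l2_inner U F w + l2_inner U G u"
    by (intro tendsto_add tendsto_l2_inner F G uw \<psi>)
  then show ?thesis
    using eq[OF \<psi>(1)] by (simp add: LIMSEQ_const_iff)
qed


section \<open>A smooth cutoff\<close>

text \<open>The family of functions \<open>p(1/x) exp(- 1/x)\<close> on the positive half-line, extended by zero, contains
  the standard smooth function \<open>exp(- 1/x)\<close> as the case \<open>p = 1\<close>.  Admitting an arbitrary polynomial
  \<open>p\<close> makes the family closed under differentiation, which turns smoothness into an induction.\<close>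

definition flat :: "real poly \<Rightarrow> real \<Rightarrow> real" where
  "flat p x = (if x \<le> 0 then 0 else poly p (1 / x) * exp (- (1 / x)))"

lemma flat_tendsto_0: "(flat p \<longlongrightarrow> 0) (at 0)"
proof -
  have "((\<lambda>t. poly p t / exp t) \<longlongrightarrow> (\<Sum>i\<le>degree p. coeff p i * 0)) at_top"
    unfolding poly_altdef sum_divide_distrib times_divide_eq_right[symmetric]
    by (intro tendsto_intros tendsto_power_div_exp_0)
  then have "((\<lambda>x. poly p (inverse x) / exp (inverse x)) \<longlongrightarrow> 0) (at_right 0)"
    by (intro filterlim_compose[OF _ filterlim_inverse_at_top_right]) simp
  then have "(flat p \<longlongrightarrow> 0) (at_right 0)"
    by (rule Lim_transform_eventually)
       (auto simp: eventually_at_right_field flat_def field_simps exp_minus intro!: exI[of _ 1])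
  moreover have "(flat p \<longlongrightarrow> 0) (at_left 0)"
    by (rule Lim_transform_eventually[OF tendsto_const])
       (auto simp: eventually_at_left_field flat_def intro!: exI[of _ "-1"])
  ultimately show ?thesis
    by (simp add: filterlim_split_at)
qed

text \<open>At the origin the difference quotient of \<open>flat p\<close> is again a member of the family, with polynomial
  \<open>X p\<close>, so differentiability there is an instance of \<open>flat_tendsto_0\<close>.\<close>

lemma flat_has_derivative:
  "(flat p has_real_derivative flat ([:0, 0, 1:] * (p - pderiv p)) x) (at x)"
proof (cases x "0 :: real" rule: linorder_cases)
  case less
  have "((\<lambda>_. 0) has_real_derivative 0) (at x)"
    by simp
  then have "(flat p has_real_derivative 0) (at x)"
    by (rule has_field_derivative_transform_within_open[where S = "{..<0}"])
       (use less in \<open>auto simp: flat_def\<close>)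
  then show ?thesis
    using less by (simp add: flat_def)
next
  case equal
  have "((\<lambda>h. (flat p (0 + h) - flat p 0) / h) \<longlongrightarrow> 0) (at 0)"
    by (rule Lim_transform_eventually[OF flat_tendsto_0[of "pCons 0 p"]])
       (auto simp: eventually_at flat_def intro!: exI[of _ 1])
  then show ?thesis
    using equal by (simp add: DERIV_def flat_def)
next
  case greater
  have "((\<lambda>x. poly p (1 / x) * exp (- (1 / x))) has_real_derivative
      flat ([:0, 0, 1:] * (p - pderiv p)) x) (at x)"
    using greater
    by (auto intro!: derivative_eq_intros DERIV_chain'[OF _ poly_DERIV]
        simp: flat_def power2_eq_square field_simps)
  then show ?thesis
    by (rule has_field_derivative_transform_within_open[where S = "{0<..}"])
       (use greater in \<open>auto simp: flat_def\<close>)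
qed

text \<open>The factor \<open>r\<close> is general because every differentiation produces another factor \<open>s\<close>.\<close>

lemma Ck_on_flat: "Ck_on n UNIV (\<lambda>x. r * flat p (s * x + t))"
proof (induction n arbitrary: r p)
  case 0
  have "continuous_on UNIV (flat p)"
    using flat_has_derivative by (meson DERIV_isCont continuous_at_imp_continuous_on)
  then show ?case
    by (auto intro!: continuous_intros continuous_on_compose2[of UNIV "flat p"])
next
  case (Suc n)
  define q where "q = [:0, 0, 1:] * (p - pderiv p)"
  have D: "((\<lambda>x. r * flat p (s * x + t)) has_real_derivative (r * s) * flat q (s * x + t)) (at x)" for x
    unfolding q_def by (auto intro!: derivative_eq_intros DERIV_chain'[OF _ flat_has_derivative])
  then have "partial 1 (\<lambda>x. r * flat p (s * x + t)) = (\<lambda>x. (r * s) * flat q (s * x + t))"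
    by (simp add: fun_eq_iff has_field_derivative_def partial_has_derivative[OF D[unfolded has_field_derivative_def]])
  then show ?case
    using Suc.IH[of "r * s" q] D by (auto simp: has_field_derivative_def differentiable_def)
qed

text \<open>The cutoff is \<open>f (\<alpha> - y) + f (y - \<beta>)\<close> with \<open>f = flat 1\<close>, which vanishes exactly on
  \<open>{\<alpha>..\<beta>}\<close>.  It need not be constant on \<open>(a, b)\<close>: because \<open>f\<close> is monotone, its two summands there are at
  least \<open>f (\<alpha> - b)\<close> and \<open>f (a - \<beta>)\<close>, one of which is positive.\<close>

lemma smooth_cutoff_outside_interval:
  fixes \<alpha> \<beta> a b :: real
  assumes "b < \<alpha> \<or> \<beta> < a"
  obtains \<eta> :: "real \<Rightarrow> real" and \<delta> where "smooth_on UNIV \<eta>" "\<delta> > 0"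
    "\<And>y. y \<in> {a<..<b} \<Longrightarrow> \<delta> \<le> \<eta> y" "\<And>y. y \<in> {\<alpha>..\<beta>} \<Longrightarrow> \<eta> y = 0"
proof
  let ?\<eta> = "\<lambda>y. 1 * flat 1 ((-1) * y + \<alpha>) + 1 * flat 1 (1 * y + (- \<beta>))"
  show "smooth_on UNIV ?\<eta>"
    unfolding smooth_on_def by (intro allI Ck_on_add Ck_on_flat)
  have mono: "flat 1 x \<le> flat 1 y" if "x \<le> y" for x y
    using that by (auto simp: flat_def field_simps)
  have nn: "0 \<le> flat 1 x" for x
    by (auto simp: flat_def)
  show "flat 1 (\<alpha> - b) + flat 1 (a - \<beta>) > 0"
    using assms nn[of "\<alpha> - b"] nn[of "a - \<beta>"]
    by (auto simp: flat_def intro: add_pos_nonneg add_nonneg_pos)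
  show "flat 1 (\<alpha> - b) + flat 1 (a - \<beta>) \<le> ?\<eta> y" if "y \<in> {a<..<b}" for y
    using that mono[of "\<alpha> - b" "\<alpha> - y"] mono[of "a - \<beta>" "y - \<beta>"] by simp
  show "?\<eta> y = 0" if "y \<in> {\<alpha>..\<beta>}" for y
    using that by (simp add: flat_def)
qed


section \<open>The energy estimate\<close>

text \<open>The eigenvalue equation is tested with \<open>\<eta>\<^sup>2\<close> times the conjugate of \<open>u\<close>.  The cross term
  \<open>2 c \<eta> \<eta>' Re (u' * cnj u)\<close> is absorbed by \<open>2 x y \<le> x\<^sup>2 + y\<^sup>2\<close>, which consumes exactly the
  gradient term \<open>c \<eta>\<^sup>2 |u'|\<^sup>2\<close>.  No derivative of \<open>c\<close> appears, so a rough coefficient is allowed.\<close>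

lemma Caccioppoli_inequality:
  fixes u :: "real \<Rightarrow> complex" and \<eta> :: "real \<Rightarrow> real"
  assumes eig: "(u, \<lambda>y. of_real l * u y) \<in> reduced_operator H c \<mu>"
    and c: "c \<in> borel_measurable (lebesgue_on {0<..<H})"
    and c_bd: "AE y in lebesgue_on {0<..<H}. 0 \<le> c y \<and> c y \<le> B"
    and \<eta>: "smooth_on UNIV \<eta>"
    and M: "\<And>y. y \<in> {0<..<H} \<Longrightarrow> \<bar>partial 1 \<eta> y\<bar> \<le> M"
  shows "integrable (lebesgue_on {0<..<H}) (\<lambda>y. (c y * \<mu>\<^sup>2 - l) * (\<eta> y)\<^sup>2 * (cmod (u y))\<^sup>2)"
    and "(LINT y|lebesgue_on {0<..<H}. (c y * \<mu>\<^sup>2 - l) * (\<eta> y)\<^sup>2 * (cmod (u y))\<^sup>2) \<le>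
           B * M\<^sup>2 * (LINT y|lebesgue_on {0<..<H}. (cmod (u y))\<^sup>2)"
proof -
  let ?I = "{0<..<H}" and ?\<eta>' = "partial 1 \<eta>"
  let ?L = "lebesgue_on ?I"
  obtain w z where u: "u \<in> H10 ?I" and w: "weak_deriv ?I 1 u w"
    and z: "weak_deriv ?I 1 (\<lambda>y. of_real (c y) * w y) z"
    and zu: "AE y in ?L. of_real l * u y = of_real (c y * \<mu>\<^sup>2) * u y - z y"
    using eig by (auto simp: reduced_operator_def)
  have I: "?I \<in> lmeasurable" "bounded ?I"
    by auto
  define v where "v = (\<lambda>y. c y *\<^sub>R w y)"
  have uL: "u \<in> L2 ?I" and wL: "w \<in> L2 ?I" and vL: "v \<in> L2 ?I" and zL: "z \<in> L2 ?I"
    using w z by (auto simp: weak_deriv_def v_def scaleR_conv_of_real)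
  have smooth2: "smooth_on UNIV (\<lambda>y. (\<eta> y)\<^sup>2)"
    using smooth_on_scaleR[OF \<eta> \<eta>] by (simp add: power2_eq_square)
  have d2: "partial 1 (\<lambda>y. (\<eta> y)\<^sup>2) y = 2 * \<eta> y * ?\<eta>' y" for y
    using partial_scaleR[OF smooth_on_differentiable[OF \<eta>] smooth_on_differentiable[OF \<eta>], where b = 1 and x = y]
    by (simp add: power2_eq_square)
  have mult_L2: "(\<lambda>y. m y *\<^sub>R f y) \<in> L2 ?I" if "smooth_on UNIV m" "f \<in> L2 ?I" for m :: "real \<Rightarrow> real" and f
  proof -
    have cont: "continuous_on UNIV m"
      using that(1) by (rule smooth_on_continuous)
    then have "compact (m ` {0..H})"
      by (intro compact_continuous_image) (auto intro: continuous_on_subset)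
    then obtain K where K: "\<forall>y\<in>m ` {0..H}. norm y \<le> K"
      using compact_imp_bounded[of "m ` {0..H}"] unfolding bounded_iff by blast
    then have "AE y in ?L. \<bar>m y\<bar> \<le> K"
      by (intro AE_I2) auto
    moreover have "m \<in> borel_measurable ?L"
      by (intro continuous_imp_measurable_on_sets_lebesgue continuous_on_subset[OF cont]) auto
    ultimately show ?thesis
      using L2_mult_bounded that(2) by blast
  qed
  \<comment> \<open>Collecting the terms with \<open>\<psi>'\<close> and with \<open>\<psi>\<close> in the equation tested with \<open>\<eta>\<^sup>2 cnj \<psi>\<close>.\<close>
  define F where "F = (\<lambda>y. (\<eta> y)\<^sup>2 *\<^sub>R v y)"
  define G where "G = (\<lambda>y. (\<eta> y)\<^sup>2 *\<^sub>R z y + partial 1 (\<lambda>y. (\<eta> y)\<^sup>2) y *\<^sub>R v y)"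
  have FL: "F \<in> L2 ?I" and GL: "G \<in> L2 ?I"
    unfolding F_def G_def
    by (intro L2_add mult_L2 smooth2 smooth_on_partial vL zL; simp)+
  have "l2_inner ?I F w + l2_inner ?I G u = 0"
  proof (rule weak_equation_extends_to_H10[OF I _ u w FL GL])
    fix \<psi> assume \<psi>: "test_fun ?I \<psi>"
    then have s: "smooth_on UNIV \<psi>"
      by (simp add: test_fun_def)
    have L: "\<psi> \<in> L2 ?I" "partial 1 \<psi> \<in> L2 ?I"
      using I s by (auto intro!: L2_continuous smooth_on_continuous smooth_on_partial)
    define \<zeta> where "\<zeta> = (\<lambda>y. (\<eta> y)\<^sup>2 *\<^sub>R cnj (\<psi> y))"
    have \<zeta>: "test_fun ?I \<zeta>"
      unfolding \<zeta>_def by (rule test_fun_scaleR_cnj[OF smooth2 \<psi>])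
    have d\<zeta>: "partial 1 \<zeta> y = (\<eta> y)\<^sup>2 *\<^sub>R cnj (partial 1 \<psi> y) + partial 1 (\<lambda>y. (\<eta> y)\<^sup>2) y *\<^sub>R cnj (\<psi> y)" for y
      unfolding \<zeta>_def
      using smooth_on_differentiable[OF smooth2] smooth_on_differentiable[OF smooth_on_cnj[OF s]]
        smooth_on_differentiable[OF s]
      by (simp add: partial_scaleR partial_bounded_linear[OF bounded_linear_cnj])
    have "F y * cnj (partial 1 \<psi> y) + G y * cnj (\<psi> y) = v y * partial 1 \<zeta> y + z y * \<zeta> y" for y
      unfolding d\<zeta> unfolding F_def G_def \<zeta>_def by (simp add: scaleR_conv_of_real algebra_simps)
    moreover have "integrable ?L (\<lambda>y. z y * \<zeta> y)"
    proof -
      have "integrable ?L (\<lambda>y. z y * cnj (cnj (\<zeta> y)))"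
        by (rule integrable_L2_inner[OF zL])
          (use I \<zeta> in \<open>auto simp: test_fun_def intro!: L2_continuous smooth_on_continuous smooth_on_cnj\<close>)
      then show ?thesis
        by simp
    qed
    moreover have "integrable ?L (\<lambda>y. v y * partial 1 \<zeta> y)"
    proof -
      have "integrable ?L (\<lambda>y. v y * cnj (cnj (partial 1 \<zeta> y)))"
        by (rule integrable_L2_inner[OF vL])
          (use I \<zeta> in \<open>auto simp: test_fun_def intro!: L2_continuous smooth_on_continuous smooth_on_cnj smooth_on_partial\<close>)
      then show ?thesis
        by simp
    qed
    moreover have "(LINT y|?L. v y * partial 1 \<zeta> y) = - (LINT y|?L. z y * \<zeta> y)"
      using z \<zeta> by (simp add: weak_deriv_def v_def scaleR_conv_of_real)
    moreover note Bochner_Integration.integral_add[OF integrable_L2_inner[OF FL L(2)] integrable_L2_inner[OF GL L(1)]]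
    ultimately show "l2_inner ?I F (partial 1 \<psi>) + l2_inner ?I G \<psi> = 0"
      by (simp add: l2_inner_def)
  qed simp
  then have "(LINT y|?L. F y * cnj (w y) + G y * cnj (u y)) = 0"
    using integrable_L2_inner[OF FL wL] integrable_L2_inner[OF GL uL] by (simp add: l2_inner_def)
  moreover have iQ: "integrable ?L (\<lambda>y. F y * cnj (w y) + G y * cnj (u y))"
    using integrable_L2_inner[OF FL wL] integrable_L2_inner[OF GL uL] by simp
  ultimately have Q0: "(LINT y|?L. Re (F y * cnj (w y) + G y * cnj (u y))) = 0"
    using integral_Re[OF iQ] by simp
  have cmod_sq: "(cmod x)\<^sup>2 = Re x * Re x + Im x * Im x" for x
    unfolding cmod_power2 by (simp add: power2_eq_square)
  have iu: "integrable ?L (\<lambda>y. (cmod (u y))\<^sup>2)"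
    using uL by (simp add: L2_def)
  show iV: "integrable ?L (\<lambda>y. (c y * \<mu>\<^sup>2 - l) * (\<eta> y)\<^sup>2 * (cmod (u y))\<^sup>2)"
  proof -
    have "(\<lambda>y. c y *\<^sub>R u y) \<in> L2 ?I"
      by (rule L2_mult_bounded[OF uL c]) (use c_bd in eventually_elim, auto)
    from mult_L2[OF smooth2 this] mult_L2[OF smooth2 uL]
    have "integrable ?L (\<lambda>y. of_real (\<mu>\<^sup>2) * ((\<eta> y)\<^sup>2 *\<^sub>R (c y *\<^sub>R u y) * cnj (u y)) - of_real l * ((\<eta> y)\<^sup>2 *\<^sub>R u y * cnj (u y)))"
      by (intro Bochner_Integration.integrable_diff integrable_mult_right integrable_L2_inner uL)
    then have "integrable ?L (\<lambda>y. Re (of_real (\<mu>\<^sup>2) * ((\<eta> y)\<^sup>2 *\<^sub>R (c y *\<^sub>R u y) * cnj (u y)) - of_real l * ((\<eta> y)\<^sup>2 *\<^sub>R u y * cnj (u y))))"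
      by (rule integrable_Re)
    moreover have "Re (of_real (\<mu>\<^sup>2) * ((\<eta> y)\<^sup>2 *\<^sub>R (c y *\<^sub>R u y) * cnj (u y)) - of_real l * ((\<eta> y)\<^sup>2 *\<^sub>R u y * cnj (u y))) =
        (c y * \<mu>\<^sup>2 - l) * (\<eta> y)\<^sup>2 * (cmod (u y))\<^sup>2" for y
      unfolding cmod_sq by (simp add: power2_eq_square algebra_simps)
    ultimately show ?thesis
      by simp
  qed
  \<comment> \<open>Adding the vanishing integral of \<open>Re (F cnj w + G cnj u)\<close> makes the integrand pointwise nonnegative.\<close>
  have "0 \<le> (LINT y|?L. (B * M\<^sup>2 * (cmod (u y))\<^sup>2 - (c y * \<mu>\<^sup>2 - l) * (\<eta> y)\<^sup>2 * (cmod (u y))\<^sup>2) +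
      Re (F y * cnj (w y) + G y * cnj (u y)))"
  proof (rule integral_nonneg_AE)
    show "AE y in ?L. 0 \<le> (B * M\<^sup>2 * (cmod (u y))\<^sup>2 - (c y * \<mu>\<^sup>2 - l) * (\<eta> y)\<^sup>2 * (cmod (u y))\<^sup>2) +
      Re (F y * cnj (w y) + G y * cnj (u y))"
      using zu c_bd AE_space
    proof eventually_elim
      case (elim y)
      have zy: "z y = of_real (c y * \<mu>\<^sup>2 - l) * u y"
        using elim(1) by (simp add: algebra_simps)
      have Qy: "Re (F y * cnj (w y) + G y * cnj (u y)) =
          c y * (\<eta> y)\<^sup>2 * (cmod (w y))\<^sup>2 + (c y * \<mu>\<^sup>2 - l) * (\<eta> y)\<^sup>2 * (cmod (u y))\<^sup>2 +
          c y * (2 * \<eta> y * ?\<eta>' y * Re (w y * cnj (u y)))"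
        unfolding F_def G_def v_def zy d2 cmod_sq
        by (simp add: power2_eq_square algebra_simps)
      have "\<bar>2 * \<eta> y * ?\<eta>' y * Re (w y * cnj (u y))\<bar> \<le> 2 * (\<bar>\<eta> y\<bar> * cmod (w y)) * (\<bar>?\<eta>' y\<bar> * cmod (u y))"
        using mult_left_mono[OF abs_Re_le_cmod[of "w y * cnj (u y)"], of "2 * \<bar>\<eta> y\<bar> * \<bar>?\<eta>' y\<bar>"]
        by (simp add: abs_mult norm_mult mult_ac)
      also have "\<dots> \<le> (\<eta> y)\<^sup>2 * (cmod (w y))\<^sup>2 + (?\<eta>' y)\<^sup>2 * (cmod (u y))\<^sup>2"
        using sum_squares_bound[of "\<bar>\<eta> y\<bar> * cmod (w y)" "\<bar>?\<eta>' y\<bar> * cmod (u y)"]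
        by (simp add: power_mult_distrib)
      finally have "0 \<le> (\<eta> y)\<^sup>2 * (cmod (w y))\<^sup>2 + (?\<eta>' y)\<^sup>2 * (cmod (u y))\<^sup>2 + 2 * \<eta> y * ?\<eta>' y * Re (w y * cnj (u y))"
        by linarith
      then have "0 \<le> c y * ((\<eta> y)\<^sup>2 * (cmod (w y))\<^sup>2 + (?\<eta>' y)\<^sup>2 * (cmod (u y))\<^sup>2 + 2 * \<eta> y * ?\<eta>' y * Re (w y * cnj (u y)))"
        using elim(2) by simp
      moreover have "c y * (?\<eta>' y)\<^sup>2 * (cmod (u y))\<^sup>2 \<le> B * M\<^sup>2 * (cmod (u y))\<^sup>2"
      proof -
        have "\<bar>?\<eta>' y\<bar> \<le> M"
          using elim(3) M by simp
        then have "(?\<eta>' y)\<^sup>2 \<le> M\<^sup>2"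
          using abs_le_square_iff by fastforce
        then show ?thesis
          using elim(2) by (intro mult_mono mult_right_mono) auto
      qed
      ultimately show ?case
        unfolding Qy by (simp add: algebra_simps)
    qed
  qed
  also have "\<dots> = (LINT y|?L. B * M\<^sup>2 * (cmod (u y))\<^sup>2 - (c y * \<mu>\<^sup>2 - l) * (\<eta> y)\<^sup>2 * (cmod (u y))\<^sup>2)"
    using Bochner_Integration.integral_add[OF Bochner_Integration.integrable_diff[OF integrable_mult_right[OF iu] iV] integrable_Re[OF iQ]] Q0
    by simp
  also have "\<dots> = B * M\<^sup>2 * (LINT y|?L. (cmod (u y))\<^sup>2) - (LINT y|?L. (c y * \<mu>\<^sup>2 - l) * (\<eta> y)\<^sup>2 * (cmod (u y))\<^sup>2)"
    using Bochner_Integration.integral_diff[OF integrable_mult_right[OF iu] iV] by simp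
  finally show "(LINT y|?L. (c y * \<mu>\<^sup>2 - l) * (\<eta> y)\<^sup>2 * (cmod (u y))\<^sup>2) \<le>
      B * M\<^sup>2 * (LINT y|?L. (cmod (u y))\<^sup>2)"
    by simp
qed


section \<open>Integrals of products over product sets\<close>

text \<open>The exceptional set lies in the union of two strips over null sets, which are null in the product.\<close>

lemma AE_lborel_prodI:
  assumes "AE x in lborel. P x" "AE y in lborel. Q y"
  shows "AE p in (lborel :: ('a::euclidean_space \<times> 'b::euclidean_space) measure). P (fst p) \<and> Q (snd p)"
proof -
  obtain N where N: "N \<in> null_sets lborel" "{x. \<not> P x} \<subseteq> N"
    using assms(1) by (auto elim!: AE_E simp: null_sets_def)
  obtain K where K: "K \<in> null_sets lborel" "{x. \<not> Q x} \<subseteq> K"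
    using assms(2) by (auto elim!: AE_E simp: null_sets_def)
  have "N \<times> UNIV \<union> UNIV \<times> K \<in> null_sets (lborel \<Otimes>\<^sub>M lborel)"
    using N K by (intro null_sets.Un lborel.times_in_null_sets1 lborel.times_in_null_sets2) auto
  then show ?thesis
    unfolding lborel_prod using N K by (auto intro!: AE_I')
qed

text \<open>Lebesgue measure on the product is the completion of the product measure and not the product of
  the completed factors.  Hence the factors are first replaced by Borel functions that agree with
  them almost everywhere, and Tonelli's theorem is applied to these.  Working with nonnegative
  functions covers the case of infinite integrals as well: both sides are then values of
  \<open>enn2real\<close>, which is multiplicative.\<close>

lemma LINT_lebesgue_on_Times:
  fixes f :: "'a::euclidean_space \<Rightarrow> real" and g :: "'b::euclidean_space \<Rightarrow> real"
  assumes A: "A \<in> sets borel" and B: "B \<in> sets borel"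
    and f: "f \<in> borel_measurable (lebesgue_on A)" "\<And>x. 0 \<le> f x"
    and g: "g \<in> borel_measurable (lebesgue_on B)" "\<And>y. 0 \<le> g y"
  shows "(LINT p|lebesgue_on (A \<times> B). f (fst p) * g (snd p)) =
    (LINT x|lebesgue_on A. f x) * (LINT y|lebesgue_on B. g y)"
proof -
  let ?f = "\<lambda>x. indicator A x * f x" and ?g = "\<lambda>y. indicator B y * g y"
  have meas_f: "?f \<in> borel_measurable lebesgue" and meas_g: "?g \<in> borel_measurable lebesgue"
    using f g A B by (auto simp: borel_measurable_restrict_space_iff)
  then obtain f' g' where f': "f' \<in> borel_measurable lborel" "AE x in lborel. ?f x = f' x"
    and g': "g' \<in> borel_measurable lborel" "AE x in lborel. ?g x = g' x"
    by (metis completion_ex_borel_measurable_real)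
  define F where "F = (\<lambda>x. ennreal (f' x))"
  define G where "G = (\<lambda>x. ennreal (g' x))"
  have FG: "F \<in> borel_measurable lborel" "G \<in> borel_measurable lborel"
    using f' g' by (auto simp: F_def G_def)
  have AB: "A \<times> B \<in> sets borel"
    using A B by (rule borel_Times)
  have ae_real: "AE p in lborel. f' (fst p) * g' (snd p) = indicator (A \<times> B) p * (f (fst p) * g (snd p))"
    using AE_lborel_prodI[OF f'(2) g'(2)]
  proof eventually_elim
    case (elim p)
    then have "f' (fst p) = indicator A (fst p) * f (fst p)" "g' (snd p) = indicator B (snd p) * g (snd p)"
      by simp_all
    then show ?case
      by (cases p) (simp add: indicator_times)
  qed
  have ae: "AE p in lborel. F (fst p) * G (snd p) = ennreal (indicator (A \<times> B) p * (f (fst p) * g (snd p)))"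
    using AE_lborel_prodI[OF f'(2) g'(2)] ae_real
  proof eventually_elim
    case (elim p)
    then have "0 \<le> f' (fst p)" "0 \<le> g' (snd p)"
      using f(2)[of "fst p"] g(2)[of "snd p"] by (metis indicator_pos_le mult_nonneg_nonneg)+
    then show ?case
      using elim(2) by (simp add: F_def G_def ennreal_mult[symmetric])
  qed
  have prod: "(\<integral>\<^sup>+p. F (fst p) * G (snd p) \<partial>lborel) = (\<integral>\<^sup>+x. F x \<partial>lborel) * (\<integral>\<^sup>+y. G y \<partial>lborel)"
  proof -
    have "(\<integral>\<^sup>+p. F (fst p) * G (snd p) \<partial>lborel) = (\<integral>\<^sup>+x. \<integral>\<^sup>+y. F x * G y \<partial>lborel \<partial>lborel)"
      using FG by (subst lborel_prod[symmetric], subst lborel.nn_integral_fst[symmetric]) simp_all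
    also have "\<dots> = (\<integral>\<^sup>+x. F x \<partial>lborel) * (\<integral>\<^sup>+y. G y \<partial>lborel)"
      using FG by (simp add: nn_integral_cmult nn_integral_multc)
    finally show ?thesis .
  qed
  have int: "(LINT x|lebesgue_on S. h x) = enn2real (\<integral>\<^sup>+x. K x \<partial>lborel)"
    if "S \<in> sets borel" "(\<lambda>x. indicator S x * h x) \<in> borel_measurable lebesgue" "\<And>x. 0 \<le> h x"
      "AE x in lborel. K x = ennreal (indicator S x * h x)"
    for S and h :: "'c::euclidean_space \<Rightarrow> real" and K
  proof -
    have "(LINT x|lebesgue_on S. h x) = (LINT x|lebesgue. indicator S x * h x)"
      using that(1) by (subst integral_restrict_space) auto
    also have "\<dots> = enn2real (\<integral>\<^sup>+x. ennreal (indicator S x * h x) \<partial>lebesgue)"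
      using that by (intro integral_eq_nn_integral) auto
    also have "(\<integral>\<^sup>+x. ennreal (indicator S x * h x) \<partial>lebesgue) = (\<integral>\<^sup>+x. K x \<partial>lborel)"
      unfolding nn_integral_completion using that(4) by (intro nn_integral_cong_AE) auto
    finally show ?thesis .
  qed
  have "(\<lambda>p. f' (fst p) * g' (snd p)) \<in> borel_measurable lebesgue"
    using f'(1) g'(1) by (intro measurable_completion) (simp add: borel_prod[symmetric])
  then have meas: "(\<lambda>p. indicator (A \<times> B) p * (f (fst p) * g (snd p))) \<in> borel_measurable lebesgue"
    by (rule borel_measurable_AE) (rule AE_completion[OF ae_real])
  have "(LINT p|lebesgue_on (A \<times> B). f (fst p) * g (snd p)) =
      enn2real ((\<integral>\<^sup>+x. F x \<partial>lborel) * (\<integral>\<^sup>+y. G y \<partial>lborel))"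
    using int[OF AB meas _ ae] f(2) g(2) prod by simp
  also have "\<dots> = enn2real (\<integral>\<^sup>+x. F x \<partial>lborel) * enn2real (\<integral>\<^sup>+y. G y \<partial>lborel)"
    by (rule enn2real_mult)
  also have "enn2real (\<integral>\<^sup>+x. F x \<partial>lborel) = (LINT x|lebesgue_on A. f x)"
    by (rule int[OF A meas_f f(2), symmetric]) (use f'(2) in \<open>auto simp: F_def\<close>)
  also have "enn2real (\<integral>\<^sup>+y. G y \<partial>lborel) = (LINT y|lebesgue_on B. g y)"
    by (rule int[OF B meas_g g(2), symmetric]) (use g'(2) in \<open>auto simp: G_def\<close>)
  finally show ?thesis .
qed


section \<open>Decay outside the well\<close>

text \<open>Positivity excludes the case of an infinite essential supremum of \<open>- c\<close>, which
  \<open>real_of_ereal\<close> would send to zero.\<close>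

lemma AE_ess_inf_on_le:
  assumes "0 < ess_inf_on S c"
  shows "AE x in lebesgue_on S. ess_inf_on S c \<le> c x"
proof -
  define e where "e = esssup (lebesgue_on S) (\<lambda>x. ereal (- c x))"
  have "real_of_ereal e < 0"
    using assms by (simp add: ess_inf_on_def ess_sup_on_def e_def)
  then have e: "e = ereal (- ess_inf_on S c)"
    by (cases e) (auto simp: ess_inf_on_def ess_sup_on_def e_def)
  have "AE x in lebesgue_on S. ereal (- c x) \<le> e"
    unfolding e_def by (rule esssup_AE)
  then show ?thesis
    by eventually_elim (simp add: e)
qed

lemma closure_layer: "closure (layer U a b) = closure U \<times> closure {a<..<b}"
  by (simp add: layer_def closure_Times)

text \<open>If the closed intervals met, the larger of the two left endpoints would lie in both.\<close>

lemma disjoint_closed_layers_apart: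
  assumes "U \<noteq> {}" "a < b" "\<alpha> < \<beta>"
    and "closure (layer U a b) \<inter> closure (layer U \<alpha> \<beta>) = {}"
  shows "b < \<alpha> \<or> \<beta> < a"
proof (rule ccontr)
  assume *: "\<not> (b < \<alpha> \<or> \<beta> < a)"
  obtain p where "p \<in> closure U"
    using assms(1) closure_subset by blast
  moreover have "max a \<alpha> \<in> {a..b} \<inter> {\<alpha>..\<beta>}"
    using * assms by auto
  ultimately have "(p, max a \<alpha>) \<in> closure (layer U a b) \<inter> closure (layer U \<alpha> \<beta>)"
    using assms(2,3) by (auto simp: closure_layer)
  then show False
    using assms(4) by blast
qed

text \<open>Where the cutoff does not vanish, \<open>c \<mu>\<^sup>2 - l \<ge> c\<^sub>1 \<mu>\<^sup>2 - (c\<^sub>1 - \<epsilon>) \<mu>\<^sup>2 = \<epsilon> \<mu>\<^sup>2\<close>, so the energy estimate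
  controls the mass in \<open>(a, b)\<close> multiplied by \<open>\<mu>\<^sup>2\<close>.  That the constant is uniform in \<open>\<mu>\<close> and \<open>l\<close> is
  what gives decay along the eigenvalues.\<close>

lemma eigenfunction_mass_outside_well:
  fixes c :: "real \<Rightarrow> real"
  assumes c: "c \<in> Linf {0..H}" and pos: "0 < ess_inf_on {0..H} c"
    and well: "well H c \<alpha> \<beta> c1" and "\<epsilon> > 0"
    and ab: "{a<..<b} \<subseteq> {0<..<H}" and apart: "b < \<alpha> \<or> \<beta> < a"
  obtains K where "\<And>\<mu> l u. (u, \<lambda>y. of_real l * u y) \<in> reduced_operator H c \<mu> \<Longrightarrow>
      l \<le> (c1 - \<epsilon>) * \<mu>\<^sup>2 \<Longrightarrow>
      \<mu>\<^sup>2 * (LINT y|lebesgue_on {a<..<b}. (cmod (u y))\<^sup>2) \<le>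
        K * (LINT y|lebesgue_on {0<..<H}. (cmod (u y))\<^sup>2)"
proof -
  let ?L = "lebesgue_on {0<..<H}"
  obtain \<eta> :: "real \<Rightarrow> real" and \<delta> where \<eta>: "smooth_on UNIV \<eta>" and "\<delta> > 0"
    and \<eta>_ab: "\<And>y. y \<in> {a<..<b} \<Longrightarrow> \<delta> \<le> \<eta> y"
    and \<eta>_well: "\<And>y. y \<in> {\<alpha>..\<beta>} \<Longrightarrow> \<eta> y = 0"
    by (rule smooth_cutoff_outside_interval[OF apart]) (rule that)
  have "compact (partial 1 \<eta> ` {0..H})"
    using smooth_on_continuous[OF smooth_on_partial[OF \<eta>, of 1]]
    by (intro compact_continuous_image) (auto intro: continuous_on_subset)
  then obtain M where M: "\<forall>y\<in>partial 1 \<eta> ` {0..H}. norm y \<le> M"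
    using compact_imp_bounded[of "partial 1 \<eta> ` {0..H}"] unfolding bounded_iff by blast
  have sub: "{0<..<H} \<subseteq> {0..H}"
    by auto
  have c_meas: "c \<in> borel_measurable ?L"
    using c measurable_restrict_mono[OF _ sub] by (auto simp: Linf_def)
  obtain B where "AE y in lebesgue_on {0..H}. \<bar>c y\<bar> \<le> B"
    using c by (auto simp: Linf_def)
  then have "AE y in lebesgue_on {0..H}. 0 \<le> c y \<and> c y \<le> B"
    using AE_ess_inf_on_le[OF pos] by eventually_elim (use pos in auto)
  then have c_bd: "AE y in ?L. 0 \<le> c y \<and> c y \<le> B"
    using sub by (auto simp: AE_restrict_space_iff elim: eventually_mono)
  have c_out: "AE y in ?L. y \<notin> {\<alpha><..<\<beta>} \<longrightarrow> c1 \<le> c y"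
    using well by (auto simp: well_def AE_restrict_space_iff elim: eventually_mono)
  have "\<mu>\<^sup>2 * (LINT y|lebesgue_on {a<..<b}. (cmod (u y))\<^sup>2) \<le>
      B * M\<^sup>2 / (\<epsilon> * \<delta>\<^sup>2) * (LINT y|?L. (cmod (u y))\<^sup>2)"
    if eig: "(u, \<lambda>y. of_real l * u y) \<in> reduced_operator H c \<mu>" and l: "l \<le> (c1 - \<epsilon>) * \<mu>\<^sup>2"
    for \<mu> l u
  proof -
    note Cacc = Caccioppoli_inequality[OF eig c_meas c_bd \<eta>, of M]
    have M': "\<bar>partial 1 \<eta> y\<bar> \<le> M" if "y \<in> {0<..<H}" for y
      using M that by auto
    have iu: "integrable ?L (\<lambda>y. (cmod (u y))\<^sup>2)"
      using eig by (auto simp: reduced_operator_def weak_deriv_def L2_def)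
    have "(LINT y|lebesgue_on {a<..<b}. (cmod (u y))\<^sup>2) = (LINT y|?L. indicator {a<..<b} y * (cmod (u y))\<^sup>2)"
    proof -
      have "(LINT y|lebesgue_on {a<..<b}. (cmod (u y))\<^sup>2) =
          (LINT y|lebesgue. indicator {a<..<b} y *\<^sub>R (cmod (u y))\<^sup>2)"
        by (subst integral_restrict_space) auto
      also have "\<dots> = (LINT y|lebesgue. indicator {0<..<H} y *\<^sub>R (indicator {a<..<b} y * (cmod (u y))\<^sup>2))"
        using ab by (intro Bochner_Integration.integral_cong) (auto simp: indicator_def)
      also have "\<dots> = (LINT y|?L. indicator {a<..<b} y * (cmod (u y))\<^sup>2)"
        by (subst integral_restrict_space) auto
      finally show ?thesis .
    qed
    then have "\<epsilon> * \<mu>\<^sup>2 * \<delta>\<^sup>2 * (LINT y|lebesgue_on {a<..<b}. (cmod (u y))\<^sup>2) =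
        (LINT y|?L. \<epsilon> * \<mu>\<^sup>2 * \<delta>\<^sup>2 * (indicator {a<..<b} y * (cmod (u y))\<^sup>2))"
      by simp
    also have "\<dots> \<le> (LINT y|?L. (c y * \<mu>\<^sup>2 - l) * (\<eta> y)\<^sup>2 * (cmod (u y))\<^sup>2)"
    proof (rule integral_mono_AE)
      have "{a<..<b} \<in> sets ?L"
        using ab by (auto simp: sets_restrict_space_iff)
      then show "integrable ?L (\<lambda>y. \<epsilon> * \<mu>\<^sup>2 * \<delta>\<^sup>2 * (indicator {a<..<b} y * (cmod (u y))\<^sup>2))"
        using integrable_mult_indicator[OF _ iu] by simp
      show "integrable ?L (\<lambda>y. (c y * \<mu>\<^sup>2 - l) * (\<eta> y)\<^sup>2 * (cmod (u y))\<^sup>2)"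
        using Cacc(1) M' by blast
      show "AE y in ?L. \<epsilon> * \<mu>\<^sup>2 * \<delta>\<^sup>2 * (indicator {a<..<b} y * (cmod (u y))\<^sup>2) \<le>
          (c y * \<mu>\<^sup>2 - l) * (\<eta> y)\<^sup>2 * (cmod (u y))\<^sup>2"
        using c_out
      proof eventually_elim
        case (elim y)
        show ?case
        proof (cases "y \<in> {\<alpha>..\<beta>}")
          case True
          then have "y \<notin> {a<..<b}"
            using apart by auto
          then show ?thesis
            using \<eta>_well[OF True] by simp
        next
          case False
          then have "c1 * \<mu>\<^sup>2 \<le> c y * \<mu>\<^sup>2"
            using elim by (intro mult_right_mono) auto
          then have gap: "\<epsilon> * \<mu>\<^sup>2 \<le> c y * \<mu>\<^sup>2 - l"
            using l by (simp add: algebra_simps)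
          have "\<delta>\<^sup>2 * indicator {a<..<b} y \<le> (\<eta> y)\<^sup>2"
            using \<eta>_ab[of y] \<open>\<delta> > 0\<close> by (auto simp: indicator_def intro!: power_mono)
          moreover have "0 \<le> \<epsilon> * \<mu>\<^sup>2"
            using \<open>\<epsilon> > 0\<close> by simp
          moreover have "0 \<le> \<delta>\<^sup>2 * (indicator {a<..<b} y :: real)"
            by simp
          ultimately have "(\<epsilon> * \<mu>\<^sup>2) * (\<delta>\<^sup>2 * indicator {a<..<b} y) \<le> (c y * \<mu>\<^sup>2 - l) * (\<eta> y)\<^sup>2"
            using gap by (intro mult_mono) linarith+
          then have "(\<epsilon> * \<mu>\<^sup>2) * (\<delta>\<^sup>2 * indicator {a<..<b} y) * (cmod (u y))\<^sup>2 \<le>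
              (c y * \<mu>\<^sup>2 - l) * (\<eta> y)\<^sup>2 * (cmod (u y))\<^sup>2"
            by (rule mult_right_mono) simp
          then show ?thesis
            by (simp only: mult.assoc)
        qed
      qed
    qed
    also have "\<dots> \<le> B * M\<^sup>2 * (LINT y|?L. (cmod (u y))\<^sup>2)"
      using Cacc(2) M' by blast
    finally show ?thesis
      using \<open>\<epsilon> > 0\<close> \<open>\<delta> > 0\<close> by (simp add: field_simps)
  qed
  then show ?thesis
    using that by blast
qed

lemma LINT_cmod_power2_layer:
  fixes f :: "'a::euclidean_space \<Rightarrow> complex" and g :: "real \<Rightarrow> complex"
  assumes "open U" "f \<in> L2 U" "g \<in> borel_measurable (lebesgue_on {a<..<b})"
  shows "(LINT x|lebesgue_on (layer U a b). (cmod (f (fst x) * g (snd x)))\<^sup>2) =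
    (LINT x|lebesgue_on U. (cmod (f x))\<^sup>2) * (LINT y|lebesgue_on {a<..<b}. (cmod (g y))\<^sup>2)"
proof -
  have "(\<lambda>x. (cmod (f x))\<^sup>2) \<in> borel_measurable (lebesgue_on U)"
    "(\<lambda>y. (cmod (g y))\<^sup>2) \<in> borel_measurable (lebesgue_on {a<..<b})"
    using assms(2,3) unfolding L2_def by (auto intro!: borel_measurable_power borel_measurable_norm)
  then show ?thesis
    unfolding layer_def norm_mult power_mult_distrib
    using assms(1) by (intro LINT_lebesgue_on_Times) auto
qed

lemma orthonormal_basis_normalized:
  assumes "orthonormal_basis U K \<phi>" "k \<in> K"
  shows "(LINT x|lebesgue_on U. (cmod (\<phi> k x))\<^sup>2) = 1"
proof -
  have "complex_of_real (LINT x|lebesgue_on U. (cmod (\<phi> k x))\<^sup>2) = l2_inner U (\<phi> k) (\<phi> k)"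
    unfolding l2_inner_def complex_norm_square[symmetric]
    by (simp del: of_real_power)
  then show ?thesis
    using assms by (simp add: orthonormal_basis_def)
qed

theorem theorem3p1:
  fixes U :: "(real ^ 'd) set"
    and H :: real
    and \<mu> :: "nat \<Rightarrow> real"
    and \<phi> :: "nat \<Rightarrow> real ^ 'd \<Rightarrow> complex"
    and c :: "real \<Rightarrow> real"
    and u :: "nat \<Rightarrow> real \<Rightarrow> real \<Rightarrow> real"
    and \<alpha> \<beta> c1 \<epsilon> a b :: real
  assumes "bounded_smooth_domain U"
    and "H > 0"
    and "\<And>k. k \<ge> 1 \<Longrightarrow> \<mu> k > 0"
    and "\<And>j k. 1 \<le> j \<Longrightarrow> j \<le> k \<Longrightarrow> (\<mu> j)\<^sup>2 \<le> (\<mu> k)\<^sup>2"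
    and "\<And>k. k \<ge> 1 \<Longrightarrow> eigenfunction U (dirichlet_laplacian U) ((\<mu> k)\<^sup>2) (\<phi> k)"
    and "orthonormal_basis U {1..} \<phi>"
    and "c \<in> Linf {0..H}"
    and "0 < ess_inf_on {0..H} c"
    and "ess_inf_on {0..H} c < ess_sup_on {0..H} c"
    and "\<And>k l. k \<ge> 1 \<Longrightarrow> eigenvalue {0<..<H} (reduced_operator H c (\<mu> k)) l \<Longrightarrow>
           eigenfunction {0<..<H} (reduced_operator H c (\<mu> k)) l (\<lambda>y. of_real (u k l y)) \<and>
           l2_norm {0<..<H} (\<lambda>y. of_real (u k l y)) = 1"
    and "well H c \<alpha> \<beta> c1"
    and "\<epsilon> > 0"
    and "a < b"
    and "{a<..<b} \<subseteq> {0<..<H}"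
    and "closure (layer U a b) \<subseteq> closure (layer U 0 H) - closure (layer U \<alpha> \<beta>)"
  shows "((\<lambda>(k, l). LINT x|lebesgue_on (layer U a b).
              (cmod (\<phi> k (fst x) * of_real (u k l (snd x))))\<^sup>2) \<longlongrightarrow> 0)
           (inf (filtercomap snd at_top)
              (principal {(k, l). k \<ge> 1 \<and>
                 eigenvalue {0<..<H} (reduced_operator H c (\<mu> k)) l \<and>
                 ess_inf_on {0..H} c * (\<mu> k)\<^sup>2 \<le> l \<and> l \<le> (c1 - \<epsilon>) * (\<mu> k)\<^sup>2}))"
proof -
  let ?I = "{0<..<H}"
  let ?S = "{(k, l). k \<ge> 1 \<and>
                 eigenvalue {0<..<H} (reduced_operator H c (\<mu> k)) l \<and>
                 ess_inf_on {0..H} c * (\<mu> k)\<^sup>2 \<le> l \<and> l \<le> (c1 - \<epsilon>) * (\<mu> k)\<^sup>2}"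
  let ?F = "inf (filtercomap snd at_top) (principal ?S)"
  let ?mass = "\<lambda>(k, l). LINT x|lebesgue_on (layer U a b).
              (cmod (\<phi> k (fst x) * of_real (u k l (snd x))))\<^sup>2"
  have U: "open U" "U \<noteq> {}"
    using assms(1) by (auto simp: bounded_smooth_domain_def)
  have "\<alpha> < \<beta>"
    using assms(11) by (simp add: well_def)
  then have apart: "b < \<alpha> \<or> \<beta> < a"
    using disjoint_closed_layers_apart[OF U(2) \<open>a < b\<close>] assms(15) by blast
  obtain K where K: "\<And>\<mu> l u. (u, \<lambda>y. of_real l * u y) \<in> reduced_operator H c \<mu> \<Longrightarrow>
      l \<le> (c1 - \<epsilon>) * \<mu>\<^sup>2 \<Longrightarrow>
      \<mu>\<^sup>2 * (LINT y|lebesgue_on {a<..<b}. (cmod (u y))\<^sup>2) \<le>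
        K * (LINT y|lebesgue_on {0<..<H}. (cmod (u y))\<^sup>2)"
    using eigenfunction_mass_outside_well[OF assms(7,8,11,12,14) apart] by metis
  have bound: "norm (?mass (k, l)) \<le> (c1 - \<epsilon>) * K / l" if kl: "(k, l) \<in> ?S" and "l > 0" for k l
  proof -
    define v :: "real \<Rightarrow> complex" where "v = (\<lambda>y. of_real (u k l y))"
    define J where "J = (LINT y|lebesgue_on {a<..<b}. (cmod (v y))\<^sup>2)"
    have eig: "eigenfunction ?I (reduced_operator H c (\<mu> k)) l v" and "l2_norm ?I v = 1"
      using assms(10)[of k l] kl by (auto simp: v_def)
    then have v: "(v, \<lambda>y. of_real l * v y) \<in> reduced_operator H c (\<mu> k)"
      and norm_v: "(LINT y|lebesgue_on ?I. (cmod (v y))\<^sup>2) = 1"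
      by (auto simp: eigenfunction_def l2_norm_def)
    have "v \<in> borel_measurable (lebesgue_on ?I)"
      using v by (auto simp: reduced_operator_def weak_deriv_def L2_def)
    then have "v \<in> borel_measurable (lebesgue_on {a<..<b})"
      by (rule measurable_restrict_mono) (rule assms(14))
    then have mass: "?mass (k, l) = J"
      using LINT_cmod_power2_layer[OF U(1), of "\<phi> k" v a b] assms(6) kl
        orthonormal_basis_normalized[OF assms(6), of k]
      by (simp add: v_def J_def orthonormal_basis_def)
    have "0 \<le> J"
      by (simp add: J_def)
    \<comment> \<open>A value \<open>\<epsilon> \<ge> c1\<close> admits no positive eigenvalue in the range, so it is excluded here.\<close>
    have "0 < (c1 - \<epsilon>) * (\<mu> k)\<^sup>2"
      using kl \<open>l > 0\<close> by auto
    then have "0 < c1 - \<epsilon>"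
      by (simp add: zero_less_mult_iff)
    have "l * J \<le> ((c1 - \<epsilon>) * (\<mu> k)\<^sup>2) * J"
      using kl \<open>0 \<le> J\<close> by (intro mult_right_mono) auto
    also have "\<dots> \<le> (c1 - \<epsilon>) * K"
      using K[OF v] kl norm_v \<open>0 < c1 - \<epsilon>\<close> by (simp add: J_def)
    finally show ?thesis
      using \<open>l > 0\<close> \<open>0 \<le> J\<close> mass by (simp add: field_simps)
  qed
  have lim: "filterlim snd at_top ?F"
    by (rule filterlim_mono[OF filterlim_filtercomap]) auto
  show ?thesis
  proof (rule Lim_null_comparison)
    show "((\<lambda>p. (c1 - \<epsilon>) * K / snd p) \<longlongrightarrow> 0) ?F"
      by (rule real_tendsto_divide_at_top[OF tendsto_const lim])
    have "eventually (\<lambda>p. p \<in> ?S) ?F"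
      by (simp add: eventually_inf_principal)
    moreover have "eventually (\<lambda>p. snd p > 0) ?F"
      using lim by (simp add: filterlim_at_top_dense)
    ultimately show "eventually (\<lambda>p. norm (?mass p) \<le> (c1 - \<epsilon>) * K / snd p) ?F"
    proof eventually_elim
      case (elim p)
      then show ?case
        using bound[of "fst p" "snd p"] by (metis prod.collapse)
    qed
  qed
qed

end
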